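(* Let $T\subset\mathbb{R}^3$ be a tetrahedron of Class $n$ (b) with $n\ge 2$ (that is, of Class 2 (b) or Class 3 (b)). If an affine plane $\Pi$ induces a height function tetrahedral subdivision of $T$, then the edge $e$ of $T$ contained in $\Pi$ and the opposite edge $e'$, which $\Pi$ intersects at a point $p\in\operatorname{relint}(e')$, must both have obtuse dihedral angles in $T$.
   Context: A tetrahedron is the convex hull of four affinely independent points of $\mathbb{R}^3$. The dihedral angle of a tetrahedron at an edge $e$ is the interior angle, in $(0,\pi)$, between the two faces containing $e$; it is obtuse if it is greater than $\pi/2$. A tetrahedron is of Class $n$ if it has exactly $n$ edges with obtuse dihedral angle. For $n\ge 2$, a Class $n$ tetrahedron is of subclass (a) if all edges with obtuse dihedral angle are incident to a single common vertex, and of subclass (b) if they do not share a common vertex. (So in Class 2 (b) the two obtuse edges are opposite edges.) A polyhedron $P\subset\mathbb{R}^3$ is a height function if there is a (two-dimensional) face $F$ of $P$ such that the orthogonal projection $\pi_F:\mathbb{R}^3\to\operatorname{aff}(F)$ satisfies $\pi_F(P)\subseteq F$. An affine plane $\Pi$ induces a tetrahedral subdivision of $T$ if $T=T_0\cup T_1$ with $T_0\cap T_1=T\cap\Pi$, where $T_0,T_1$ are distinct (3-dimensional, non-degenerate) tetrahedra, one contained in each of the two closed half-spaces determined by $\Pi$. This happens exactly when $\Pi$ contains an edge $e$ of $T$ and intersects the opposite edge $e'$ in exactly one point $p\in\operatorname{relint}(e')$. The subdivision is called a height function tetrahedral subdivision if $T_0$ and $T_1$ are both height functions. *)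

theory Defs
  imports "HOL-Analysis.Analysis"
begin

abbreviation tetrahedron :: "(real^3) set \<Rightarrow> bool" where
  "tetrahedron T \<equiv> 3 simplex T"

text \<open>Intended for nonempty affine \<open>A\<close>, where the point described exists and is unique.\<close>

definition orth_proj :: "(real^3) set \<Rightarrow> real^3 \<Rightarrow> real^3" where
  "orth_proj A x = (THE y. y \<in> A \<and> (\<forall>z\<in>A. orthogonal (x - y) (z - y)))"

definition vec_angle :: "real^3 \<Rightarrow> real^3 \<Rightarrow> real" where
  "vec_angle u v = arccos ((u \<bullet> v) / (norm u * norm v))"

text \<open>
  \<open>F\<close> and \<open>G\<close> are the two faces containing \<open>e\<close>. For \<open>w \<in> F - e\<close>, the vector from the foot of
  the perpendicular dropped from \<open>w\<close> onto the line of \<open>e\<close> to \<open>w\<close> is nonzero, orthogonal to \<open>e\<close>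
  and points from \<open>e\<close> into the half-plane containing \<open>F\<close>; up to a positive factor it does not
  depend on \<open>w\<close>. Hence \<open>\<theta>\<close> is unique whenever \<open>e\<close> is an edge of a tetrahedron \<open>T\<close>.
\<close>

definition dihedral_angle :: "(real^3) set \<Rightarrow> (real^3) set \<Rightarrow> real" where
  "dihedral_angle T e =
     (THE \<theta>. \<exists>F G w z. F facet_of T \<and> G facet_of T \<and> F \<noteq> G \<and> e \<subseteq> F \<and> e \<subseteq> G \<and>
        w \<in> F - e \<and> z \<in> G - e \<and>
        \<theta> = vec_angle (w - orth_proj (affine hull e) w) (z - orth_proj (affine hull e) z))"

definition obtuse_edge :: "(real^3) set \<Rightarrow> (real^3) set \<Rightarrow> bool" where
  "obtuse_edge T e \<longleftrightarrow> e edge_of T \<and> dihedral_angle T e > pi / 2"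

definition class_n :: "nat \<Rightarrow> (real^3) set \<Rightarrow> bool" where
  "class_n n T \<longleftrightarrow> tetrahedron T \<and> card {e. obtuse_edge T e} = n"

text \<open>The subclasses are only meant for \<open>n \<ge> 2\<close>.\<close>

definition class_n_a :: "nat \<Rightarrow> (real^3) set \<Rightarrow> bool" where
  "class_n_a n T \<longleftrightarrow>
     class_n n T \<and> (\<exists>v. v extreme_point_of T \<and> (\<forall>e. obtuse_edge T e \<longrightarrow> v \<in> e))"

definition class_n_b :: "nat \<Rightarrow> (real^3) set \<Rightarrow> bool" where
  "class_n_b n T \<longleftrightarrow>
     class_n n T \<and> \<not> (\<exists>v. v extreme_point_of T \<and> (\<forall>e. obtuse_edge T e \<longrightarrow> v \<in> e))"

text \<open>In a tetrahedron, two edges are opposite iff they have no vertex in common.\<close>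

definition opposite_edges :: "(real^3) set \<Rightarrow> (real^3) set \<Rightarrow> (real^3) set \<Rightarrow> bool" where
  "opposite_edges T e e' \<longleftrightarrow> e edge_of T \<and> e' edge_of T \<and> e \<inter> e' = {}"

definition height_function :: "(real^3) set \<Rightarrow> bool" where
  "height_function P \<longleftrightarrow>
     polyhedron P \<and> (\<exists>F. F face_of P \<and> aff_dim F = 2 \<and> orth_proj (affine hull F) ` P \<subseteq> F)"

text \<open>
  Here \<open>T0\<close> lies in the half-space \<open>a \<bullet> x \<le> b\<close>; replacing \<open>(a, b)\<close> by \<open>(-a, -b)\<close> exchanges
  the two sides.
\<close>

definition tetrahedral_subdivision ::
  "(real^3) set \<Rightarrow> (real^3) set \<Rightarrow> (real^3) set \<Rightarrow> (real^3) set \<Rightarrow> bool" where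
  "tetrahedral_subdivision H T T0 T1 \<longleftrightarrow>
     tetrahedron T0 \<and> tetrahedron T1 \<and> T0 \<noteq> T1 \<and>
     T = T0 \<union> T1 \<and> T0 \<inter> T1 = T \<inter> H \<and>
     (\<exists>a b. a \<noteq> 0 \<and> H = {x. a \<bullet> x = b} \<and> T0 \<subseteq> {x. a \<bullet> x \<le> b} \<and> T1 \<subseteq> {x. a \<bullet> x \<ge> b})"

definition induces_height_function_subdivision :: "(real^3) set \<Rightarrow> (real^3) set \<Rightarrow> bool" where
  "induces_height_function_subdivision H T \<longleftrightarrow>
     (\<exists>T0 T1. tetrahedral_subdivision H T T0 T1 \<and> height_function T0 \<and> height_function T1)"

end

theory Submission
  imports Defs
begin

text \<open>
  Let \<open>a, b, c, d\<close> be the gradients of the barycentric coordinates of the tetrahedron \<open>ABCD\<close>; they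
  sum to zero. The dihedral angle at \<open>CD\<close> is obtuse iff \<open>a \<bullet> b > 0\<close>, and a tetrahedron is a height
  function only if one of its vertices has nonpositive products with all the others.

  Since the gradients sum to zero, no vertex has positive products with all three others; so in
  subclass (b) the graph of positive products has a perfect matching. Both parts of a subdivision
  have four extreme points, which forces the plane to contain two vertices \<open>A, B\<close> and to separate
  the other two, meeting \<open>CD\<close> in \<open>p = s C + t D\<close>. If \<open>a \<bullet> c > 0\<close> and \<open>b \<bullet> d > 0\<close>, then the height
  function property of \<open>ABCp\<close> gives \<open>t (a \<bullet> c) \<le> s (a \<bullet> d)\<close> and that of \<open>ABDp\<close> gives
  \<open>s (b \<bullet> d) \<le> t (b \<bullet> c)\<close>, so that \<open>(a + b) \<bullet> (c + d) > 0\<close>, contradicting \<open>c + d = - (a + b)\<close>.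
  By symmetry the matching must be \<open>{ab, cd}\<close>.
\<close>

section \<open>Orthogonal projections\<close>

lemma orth_proj_eqI:
  assumes "y \<in> A" "\<And>z. z \<in> A \<Longrightarrow> (x - y) \<bullet> (z - y) = 0"
  shows "orth_proj A x = y"
  unfolding orth_proj_def orthogonal_def
proof (rule the_equality)
  fix y' assume y': "y' \<in> A \<and> (\<forall>z\<in>A. (x - y') \<bullet> (z - y') = 0)"
  have "(y - y') \<bullet> (y - y') = (x - y) \<bullet> (y' - y) + (x - y') \<bullet> (y - y')"
    by (simp add: algebra_simps)
  also have "\<dots> = 0"
    using assms y' by simp
  finally show "y' = y"
    by simp
qed (use assms in auto)

text \<open>The nearest point of \<open>A\<close> to \<open>x\<close> satisfies the condition in the
  definition of \<open>orth_proj\<close>, so the description there denotes it.\<close>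

lemma
  assumes "affine A" "A \<noteq> {}"
  shows orth_proj_mem: "orth_proj A x \<in> A"
    and orth_proj_orthogonal: "z \<in> A \<Longrightarrow> (x - orth_proj A x) \<bullet> (z - orth_proj A x) = 0"
proof -
  have cl: "closed A"
    using closed_affine_hull[of A] assms by (metis affine_hull_eq)
  define y where "y = closest_point A x"
  have y: "y \<in> A"
    unfolding y_def using assms by (simp add: closest_point_in_set cl)
  have le: "(x - y) \<bullet> (z - y) \<le> 0" if "z \<in> A" for z
    unfolding y_def using assms that
    by (intro closest_point_dot) (auto simp: affine_imp_convex cl)
  have orth: "(x - y) \<bullet> (z - y) = 0" if "z \<in> A" for z
  proof -
    \<comment> \<open>The reflection of \<open>z\<close> in \<open>y\<close> also lies in
      \<open>A\<close>, which turns the inequality for nearest points into an equality.\<close>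
    have "2 *\<^sub>R y - z \<in> A"
      using mem_affine [OF assms(1) y that, of 2 "-1"] by simp
    from le [OF this] have "(x - y) \<bullet> (y - z) \<le> 0"
      by (simp add: scaleR_2)
    with le [OF that] show ?thesis
      by (simp add: inner_diff_right)
  qed
  have "orth_proj A x = y"
    using orth_proj_eqI y orth by blast
  then show "orth_proj A x \<in> A"
    and "z \<in> A \<Longrightarrow> (x - orth_proj A x) \<bullet> (z - orth_proj A x) = 0"
    using y orth by auto
qed

lemma orth_proj_orthogonal_diff:
  assumes "affine A" "y \<in> A" "z \<in> A"
  shows "(x - orth_proj A x) \<bullet> (y - z) = 0"
  using orth_proj_orthogonal [of A y x] orth_proj_orthogonal [of A z x] assms
  by (force simp: inner_diff_right)

section \<open>Gradients of barycentric coordinates\<close>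

text \<open>A set rather than a quadruple, so that relabelling the vertices is merely an equality of
  sets, as in the facts \<open>perm\<close> below.\<close>

definition tetra_vertices :: "(real^3) set \<Rightarrow> bool" where
  "tetra_vertices V \<longleftrightarrow> \<not> affine_dependent V \<and> card V = 4"

text \<open>The gradient of the barycentric coordinate function of \<open>v\<close> with respect to \<open>V\<close>.\<close>

definition bary_grad :: "(real^3) set \<Rightarrow> real^3 \<Rightarrow> real^3" where
  "bary_grad V v = (let h = v - orth_proj (affine hull (V - {v})) v in h /\<^sub>R (h \<bullet> h))"

lemma tetrahedron_iff: "tetrahedron T \<longleftrightarrow> (\<exists>V. tetra_vertices V \<and> T = convex hull V)"
  unfolding simplex_def tetra_vertices_def by force

lemma tetra_vertices_finite: "tetra_vertices V \<Longrightarrow> finite V"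
  unfolding tetra_vertices_def using card_gt_0_iff[of V] by simp

text \<open>The vertices affinely span the whole space, so a linear functional constant on them is
  constant everywhere; comparing its values at \<open>v\<close> and \<open>k + v\<close> gives
  \<open>k \<bullet> k = 0\<close>.\<close>

lemma tetra_vertices_eq_zeroI:
  assumes V: "tetra_vertices V" and v: "\<And>u. u \<in> V \<Longrightarrow> k \<bullet> (u - v) = 0"
  shows "k = 0"
proof -
  have "aff_dim V = 3"
    using V aff_dim_affine_independent[of V] by (simp add: tetra_vertices_def)
  then have "affine hull V = UNIV"
    using aff_dim_eq_full[of V] by simp
  moreover have "affine hull V \<subseteq> {x. k \<bullet> x = k \<bullet> v}"
    using v by (intro hull_minimal) (auto simp: affine_hyperplane inner_diff_right)
  ultimately have "k + v \<in> {x. k \<bullet> x = k \<bullet> v}"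
    by blast
  then show ?thesis
    by (simp add: inner_add_right)
qed

context
  fixes V :: "(real^3) set"
  assumes V: "tetra_vertices V"
begin

lemma facet_plane_nonempty: "affine hull (V - {v}) \<noteq> {}"
proof
  assume "affine hull (V - {v}) = {}"
  then have "V - {v} = {}"
    by (metis affine_hull_eq_empty)
  then have "card V \<le> card {v}"
    by (intro card_mono) auto
  then show False
    using V by (simp add: tetra_vertices_def)
qed

lemma vertex_ne_foot:
  assumes "v \<in> V"
  shows "v \<noteq> orth_proj (affine hull (V - {v})) v"
  using V assms orth_proj_mem[of "affine hull (V - {v})" v] facet_plane_nonempty
  by (metis affine_affine_hull affine_dependent_def tetra_vertices_def)

lemma bary_grad_foot:
  assumes "v \<in> V"
  defines "h \<equiv> v - orth_proj (affine hull (V - {v})) v"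
  shows "h \<bullet> h > 0" "h = (h \<bullet> h) *\<^sub>R bary_grad V v"
  using vertex_ne_foot[OF assms(1)] by (auto simp: h_def bary_grad_def Let_def)

lemma bary_grad_facet:
  assumes "x \<in> affine hull (V - {v})" "y \<in> affine hull (V - {v})"
  shows "bary_grad V v \<bullet> (x - y) = 0"
  using orth_proj_orthogonal_diff[OF affine_affine_hull assms]
  by (simp add: bary_grad_def Let_def)

lemma bary_grad_vertex:
  assumes "v \<in> V" "u \<in> V" "u \<noteq> v"
  shows "bary_grad V v \<bullet> (u - v) = -1"
proof -
  define h where "h = v - orth_proj (affine hull (V - {v})) v"
  have "h \<bullet> (u - orth_proj (affine hull (V - {v})) v) = 0"
    unfolding h_def using assms facet_plane_nonempty
    by (intro orth_proj_orthogonal) (auto simp: hull_inc)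
  then have "h \<bullet> (u - v) = - (h \<bullet> h)"
    unfolding h_def by (simp add: algebra_simps)
  then show ?thesis
    using bary_grad_foot(1)[OF assms(1)] unfolding bary_grad_def Let_def h_def[symmetric]
    by (simp add: field_simps)
qed

lemma bary_grad_vertices:
  assumes "v \<in> V" "u \<in> V" "w \<in> V"
  shows "bary_grad V v \<bullet> (u - w) = (if u = v then 1 else 0) - (if w = v then 1 else 0)"
  using bary_grad_vertex[of v u] bary_grad_vertex[of v w] assms
  by (auto simp: inner_diff_right)

text \<open>Differences of vertices span the space. This serves to identify the gradients of the
  parts of a subdivision.\<close>

lemma bary_grad_unique:
  assumes "v \<in> V" "\<And>u. u \<in> V \<Longrightarrow> u \<noteq> v \<Longrightarrow> k \<bullet> (u - v) = -1"
  shows "bary_grad V v = k"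
proof -
  have "bary_grad V v - k = 0"
    using assms bary_grad_vertices[of v _ v]
    by (intro tetra_vertices_eq_zeroI[OF V, of _ v]) (auto simp: inner_diff_left)
  then show ?thesis
    by simp
qed

text \<open>The left-hand side is the barycentric coordinate of \<open>x\<close> at
  \<open>v\<close>, minus 1; nonnegativity passes from the vertices to their hull.\<close>

lemma bary_coord_nonneg:
  assumes "v \<in> V" "x \<in> convex hull V"
  shows "bary_grad V v \<bullet> (x - v) \<ge> -1"
proof -
  have "convex hull V \<subseteq> {x. bary_grad V v \<bullet> x \<ge> bary_grad V v \<bullet> v - 1}"
  proof (rule hull_minimal)
    show "V \<subseteq> {x. bary_grad V v \<bullet> x \<ge> bary_grad V v \<bullet> v - 1}"
    proof
      fix u assume "u \<in> V"
      then show "u \<in> {x. bary_grad V v \<bullet> x \<ge> bary_grad V v \<bullet> v - 1}"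
        using bary_grad_vertex[of v u] assms(1) by (cases "u = v") (auto simp: inner_diff_right)
    qed
  qed (use convex_halfspace_ge in blast)
  then show ?thesis
    using assms(2) by (auto simp: inner_diff_right)
qed

lemma facet_eqE:
  assumes "F face_of convex hull V" "aff_dim F = 2"
  obtains v where "v \<in> V" "F = convex hull (V - {v})"
proof -
  obtain c where c: "c \<subseteq> V" "F = convex hull c"
    using assms V by (auto simp: face_of_convex_hull_affine_independent tetra_vertices_def)
  have "\<not> affine_dependent c"
    using c V affine_dependent_subset by (auto simp: tetra_vertices_def)
  then have "card c = 3"
    using assms(2) aff_dim_affine_independent[of c] by (simp add: c aff_dim_convex_hull)
  then have "card (V - c) = 1"
    using c V by (simp add: card_Diff_subset tetra_vertices_def finite_subset tetra_vertices_finite)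
  then obtain v where "V - c = {v}"
    by (auto simp: card_1_singleton_iff)
  then have "v \<in> V" "c = V - {v}"
    using c by auto
  with c that show thesis
    by blast
qed

lemma edge_eqE:
  assumes "e edge_of convex hull V"
  obtains u v where "u \<in> V" "v \<in> V" "u \<noteq> v" "e = convex hull {u, v}"
proof -
  obtain c where c: "c \<subseteq> V" "e = convex hull c"
    using assms V by (auto simp: edge_of_def face_of_convex_hull_affine_independent tetra_vertices_def)
  have "\<not> affine_dependent c"
    using c V affine_dependent_subset by (auto simp: tetra_vertices_def)
  then have "card c = 2"
    using assms aff_dim_affine_independent[of c] by (simp add: c edge_of_def aff_dim_convex_hull)
  with c that show thesis
    by (auto simp: card_2_iff)
qed

lemma edge_of_tetra:
  assumes "u \<in> V" "v \<in> V" "u \<noteq> v"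
  shows "convex hull {u, v} edge_of convex hull V"
proof -
  have "\<not> affine_dependent {u, v}"
    by (simp add: affine_independent_2)
  then have "aff_dim {u, v} = 1"
    using aff_dim_affine_independent[of "{u, v}"] assms by simp
  moreover have "convex hull {u, v} face_of convex hull V"
    using V assms face_of_convex_hull_affine_independent[of V] unfolding tetra_vertices_def
    by (metis empty_subsetI insert_subset)
  ultimately show ?thesis
    by (simp add: edge_of_def aff_dim_convex_hull)
qed

text \<open>The vertex \<open>v\<close> is the apex over the facet \<open>F\<close>. From
  \<open>v\<close> to the foot \<open>v - h\<close> the barycentric coordinate at \<open>u\<close>
  starts at 0 and ends nonnegative, because the foot lies in the tetrahedron; and \<open>h\<close>
  is a positive multiple of the gradient at \<open>v\<close>.\<close>

lemma height_function_bary_grad: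
  assumes "height_function (convex hull V)"
  obtains v where "v \<in> V" "\<And>u. u \<in> V \<Longrightarrow> u \<noteq> v \<Longrightarrow> bary_grad V v \<bullet> bary_grad V u \<le> 0"
proof -
  obtain F where F: "F face_of convex hull V" "aff_dim F = 2"
    "orth_proj (affine hull F) ` (convex hull V) \<subseteq> F"
    using assms by (auto simp: height_function_def)
  obtain v where v: "v \<in> V" "F = convex hull (V - {v})"
    using facet_eqE F by blast
  define h where "h = v - orth_proj (affine hull (V - {v})) v"
  have "v - h \<in> F"
    using F(3) v by (auto simp: h_def image_subset_iff hull_inc)
  then have vh: "v - h \<in> convex hull V"
    using F(1) face_of_imp_subset by blast
  have "bary_grad V v \<bullet> bary_grad V u \<le> 0" if u: "u \<in> V" "u \<noteq> v" for u
  proof -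
    have "bary_grad V u \<bullet> h = bary_grad V u \<bullet> (v - u) - bary_grad V u \<bullet> (v - h - u)"
      by (simp add: inner_diff_right)
    also have "\<dots> \<le> 0"
      using bary_coord_nonneg[OF u(1) vh] bary_grad_vertex[of u v] u v by simp
    finally have "(h \<bullet> h) * (bary_grad V u \<bullet> bary_grad V v) \<le> 0"
      using bary_grad_foot(2)[OF v(1)] unfolding h_def[symmetric] by (metis inner_scaleR_right)
    then show ?thesis
      using bary_grad_foot(1)[OF v(1)] unfolding h_def[symmetric]
      by (simp add: mult_le_0_iff inner_commute)
  qed
  with v that show thesis
    by blast
qed

end

section \<open>Dihedral angles\<close>

lemma tetra_vertices_distinct:
  "tetra_vertices {A, B, C, D} \<Longrightarrow> distinct [A, B, C, D]"
  using card_distinct[of "[A, B, C, D]"] by (simp add: tetra_vertices_def)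

lemma vertex_notin_facet:
  assumes "tetra_vertices V" "v \<in> V"
  shows "v \<notin> convex hull (V - {v})"
  using assms convex_hull_subset_affine_hull[of "V - {v}"]
  by (auto simp: tetra_vertices_def affine_dependent_def)

lemma facet_of_tetra:
  assumes "tetra_vertices V" "v \<in> V"
  shows "convex hull (V - {v}) facet_of convex hull V"
proof -
  have V: "\<not> affine_dependent V" "card V = 4" and fin: "finite V"
    using assms tetra_vertices_finite by (auto simp: tetra_vertices_def)
  have "\<not> affine_dependent (V - {v})" "card (V - {v}) = 3"
    using V assms fin by (auto simp: affine_independent_Diff)
  then have "aff_dim (V - {v}) = 2" "V - {v} \<noteq> {}"
    using aff_dim_affine_independent[of "V - {v}"] by (simp, metis card.empty zero_neq_numeral)
  moreover have "aff_dim V = 3"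
    using V aff_dim_affine_independent[of V] by simp
  moreover have "convex hull (V - {v}) face_of convex hull V"
    using face_of_convex_hull_affine_independent[OF V(1)] by blast
  ultimately show ?thesis
    by (simp add: facet_of_def aff_dim_convex_hull)
qed

lemma vec_angle_commute: "vec_angle u v = vec_angle v u"
  by (simp add: vec_angle_def inner_commute mult.commute)

lemma vec_angle_scale:
  assumes "\<alpha> > 0" "\<beta> > 0"
  shows "vec_angle (\<alpha> *\<^sub>R u) (\<beta> *\<^sub>R v) = vec_angle u v"
proof -
  have "(\<alpha> * (\<beta> * (u \<bullet> v))) / (\<alpha> * norm u * (\<beta> * norm v)) =
    ((\<alpha> * \<beta>) * (u \<bullet> v)) / ((\<alpha> * \<beta>) * (norm u * norm v))"
    by (simp add: mult_ac)
  then show ?thesis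
    using assms by (simp add: vec_angle_def)
qed

lemma vec_angle_obtuse_iff:
  assumes "u \<noteq> 0" "v \<noteq> 0"
  shows "vec_angle u v > pi / 2 \<longleftrightarrow> u \<bullet> v < 0"
proof -
  let ?c = "u \<bullet> v / (norm u * norm v)"
  have "\<bar>?c\<bar> \<le> 1"
    using assms Cauchy_Schwarz_ineq2[of u v] by simp
  then have "arccos 0 < arccos ?c \<longleftrightarrow> ?c < 0"
    by (intro arccos_less_mono) auto
  also have "\<dots> \<longleftrightarrow> u \<bullet> v < 0"
    using assms by (simp add: divide_less_0_iff mult_less_0_iff)
  finally show ?thesis
    by (simp add: vec_angle_def)
qed

text \<open>Orthogonal projection onto the line is affine and fixes \<open>C\<close> and
  \<open>D\<close>, so only the weight of \<open>X\<close> survives; it is positive because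
  \<open>w\<close> is off the edge.\<close>

lemma altitude_in_face:
  fixes X C D :: "real^3"
  defines "L \<equiv> affine hull {C, D}"
  assumes w: "w \<in> convex hull {X, C, D} - convex hull {C, D}"
  obtains \<alpha> where "\<alpha> > 0" "w - orth_proj L w = \<alpha> *\<^sub>R (X - orth_proj L X)"
proof -
  obtain \<alpha> \<gamma> \<delta> where c: "w = \<alpha> *\<^sub>R X + \<gamma> *\<^sub>R C + \<delta> *\<^sub>R D" "\<alpha> \<ge> 0" "\<gamma> \<ge> 0" "\<delta> \<ge> 0" "\<alpha> + \<gamma> + \<delta> = 1"
    using w by (auto simp: convex_hull_3)
  have "\<alpha> \<noteq> 0"
    using w c by (auto simp: convex_hull_2)
  then have "\<alpha> > 0"
    using c by simp
  have L: "affine L" "C \<in> L" "D \<in> L" "L \<noteq> {}"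
    by (auto simp: L_def hull_inc)
  define y where "y = \<alpha> *\<^sub>R orth_proj L X + \<gamma> *\<^sub>R C + \<delta> *\<^sub>R D"
  have wy: "w - y = \<alpha> *\<^sub>R (X - orth_proj L X)"
    by (simp add: c y_def algebra_simps)
  have "y \<in> L"
    unfolding y_def using L c by (intro mem_affine_3 orth_proj_mem)
  then have "orth_proj L w = y"
    using L by (intro orth_proj_eqI) (simp_all add: wy orth_proj_orthogonal_diff)
  with \<open>\<alpha> > 0\<close> wy that show thesis
    by simp
qed

text \<open>The only facets through \<open>CD\<close> are those opposite \<open>A\<close> and
  \<open>B\<close>. Other points in them rescale the altitudes by positive factors, and exchanging
  the facets preserves the angle, so the description has a single value.\<close>

lemma dihedral_angle_tetra:
  assumes V: "tetra_vertices {A, B, C, D}"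
  defines "L \<equiv> affine hull {C, D}"
  shows "dihedral_angle (convex hull {A, B, C, D}) (convex hull {C, D}) =
    vec_angle (A - orth_proj L A) (B - orth_proj L B)"
proof -
  let ?T = "convex hull {A, B, C, D}" and ?e = "convex hull {C, D}"
  note dist = tetra_vertices_distinct[OF V]
  have facets: "{A, B, C, D} - {A} = {B, C, D}" "{A, B, C, D} - {B} = {A, C, D}"
    using dist by auto
  have L: "affine hull ?e = L"
    by (simp add: L_def)
  have notin: "v \<notin> convex hull c" if "v \<in> {A, B, C, D}" "c \<subseteq> {A, B, C, D}" "v \<notin> c" for v c
  proof -
    have "convex hull c \<subseteq> convex hull ({A, B, C, D} - {v})"
      using that by (intro hull_mono) blast
    then show ?thesis
      using vertex_notin_facet[OF V that(1)] by blast
  qed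
  have facet: "F = convex hull {B, C, D} \<or> F = convex hull {A, C, D}"
    if F: "F facet_of ?T" "?e \<subseteq> F" for F
  proof -
    have "aff_dim ?T = 3"
      using V aff_dim_affine_independent[of "{A, B, C, D}"]
      unfolding aff_dim_convex_hull by (simp add: tetra_vertices_def)
    then have "F face_of ?T" "aff_dim F = 2"
      using F by (auto simp: facet_of_def)
    then obtain v where v: "v \<in> {A, B, C, D}" "F = convex hull ({A, B, C, D} - {v})"
      using facet_eqE[OF V] by blast
    have "{C, D} \<subseteq> F"
      using F(2) hull_subset[of "{C, D}" convex] by blast
    then have "v \<noteq> C" "v \<noteq> D"
      using vertex_notin_facet[OF V v(1)] v(2) by auto
    then have "v = A \<or> v = B"
      using v(1) by blast
    then show ?thesis
      using v(2) facets by metis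
  qed
  show ?thesis
    unfolding dihedral_angle_def L
  proof (rule the_equality)
    have "convex hull {A, C, D} facet_of ?T" "convex hull {B, C, D} facet_of ?T"
      using facet_of_tetra[OF V, of B, unfolded facets] facet_of_tetra[OF V, of A, unfolded facets]
      by blast+
    moreover have "A \<in> convex hull {A, C, D} - ?e" "B \<in> convex hull {B, C, D} - ?e"
      using dist notin[of A "{C, D}"] notin[of B "{C, D}"] by (auto simp: hull_inc)
    moreover have "convex hull {A, C, D} \<noteq> convex hull {B, C, D}"
    proof -
      have "A \<in> convex hull {A, C, D}" "A \<notin> convex hull {B, C, D}"
        using dist notin[of A "{B, C, D}"] by (simp_all add: hull_inc)
      then show ?thesis
        by metis
    qed
    moreover have "?e \<subseteq> convex hull {A, C, D}" "?e \<subseteq> convex hull {B, C, D}"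
      by (auto intro!: hull_mono)
    ultimately show "\<exists>F G w z. F facet_of ?T \<and> G facet_of ?T \<and> F \<noteq> G \<and> ?e \<subseteq> F \<and> ?e \<subseteq> G \<and>
        w \<in> F - ?e \<and> z \<in> G - ?e \<and>
        vec_angle (A - orth_proj L A) (B - orth_proj L B) =
        vec_angle (w - orth_proj L w) (z - orth_proj L z)"
      by blast
  next
    fix \<theta>
    assume "\<exists>F G w z. F facet_of ?T \<and> G facet_of ?T \<and> F \<noteq> G \<and> ?e \<subseteq> F \<and> ?e \<subseteq> G \<and>
        w \<in> F - ?e \<and> z \<in> G - ?e \<and>
        \<theta> = vec_angle (w - orth_proj L w) (z - orth_proj L z)"
    then obtain F G w z where FG: "F facet_of ?T" "G facet_of ?T" "F \<noteq> G" "?e \<subseteq> F" "?e \<subseteq> G"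
        and wz: "w \<in> F - ?e" "z \<in> G - ?e"
        and \<theta>: "\<theta> = vec_angle (w - orth_proj L w) (z - orth_proj L z)"
      by blast
    obtain X Y where XY: "X = A \<and> Y = B \<or> X = B \<and> Y = A"
        and FG': "F = convex hull {X, C, D}" "G = convex hull {Y, C, D}"
      using facet[of F] facet[of G] FG by blast
    obtain \<alpha> where "\<alpha> > 0" "w - orth_proj L w = \<alpha> *\<^sub>R (X - orth_proj L X)"
      using altitude_in_face wz unfolding FG' L_def by blast
    moreover obtain \<beta> where "\<beta> > 0" "z - orth_proj L z = \<beta> *\<^sub>R (Y - orth_proj L Y)"
      using altitude_in_face wz unfolding FG' L_def by blast
    ultimately have "\<theta> = vec_angle (X - orth_proj L X) (Y - orth_proj L Y)"
      by (simp add: \<theta> vec_angle_scale)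
    then show "\<theta> = vec_angle (A - orth_proj L A) (B - orth_proj L B)"
      using XY vec_angle_commute by auto
  qed
qed

text \<open>The gradients at \<open>A\<close> and \<open>B\<close> are inner normals of the two
  faces through \<open>CD\<close>, so the angle between them is the supplement of the dihedral
  angle.\<close>

lemma obtuse_edge_iff:
  assumes V: "tetra_vertices {A, B, C, D}"
  shows "obtuse_edge (convex hull {A, B, C, D}) (convex hull {C, D}) \<longleftrightarrow>
    bary_grad {A, B, C, D} A \<bullet> bary_grad {A, B, C, D} B > 0"
proof -
  let ?V = "{A, B, C, D}"
  define a b where "a = bary_grad ?V A" and "b = bary_grad ?V B"
  define L where "L = affine hull {C, D}"
  define P Q where "P = A - orth_proj L A" and "Q = B - orth_proj L B"
  note dist = tetra_vertices_distinct[OF V]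
  have L: "affine L" "L \<noteq> {}" "C \<in> L" "D \<in> L"
    by (auto simp: L_def hull_inc)
  have sub: "L \<subseteq> affine hull (?V - {A})" "L \<subseteq> affine hull (?V - {B})"
    unfolding L_def using dist by (auto intro!: hull_mono)
  have aL: "a \<bullet> (x - y) = 0" and bL: "b \<bullet> (x - y) = 0" if "x \<in> L" "y \<in> L" for x y
    unfolding a_def b_def using that sub by (blast intro: bary_grad_facet[OF V])+
  have PL: "P \<bullet> (x - y) = 0" and QL: "Q \<bullet> (x - y) = 0" if "x \<in> L" "y \<in> L" for x y
    using that L by (auto simp: P_def Q_def orth_proj_orthogonal_diff)
  have foot: "k \<bullet> (X - D) = k \<bullet> (X - orth_proj L X)"
    if k: "\<And>x y. x \<in> L \<Longrightarrow> y \<in> L \<Longrightarrow> k \<bullet> (x - y) = 0" for k X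
  proof -
    have "k \<bullet> (orth_proj L X - D) = 0"
      by (rule k) (simp_all add: L orth_proj_mem)
    then show ?thesis
      by (simp add: inner_diff_right)
  qed
  have aP: "a \<bullet> P = 1" "a \<bullet> Q = 0" and bP: "b \<bullet> P = 0" "b \<bullet> Q = 1"
    using foot[OF aL, of A] foot[OF aL, of B] foot[OF bL, of A] foot[OF bL, of B] dist
      bary_grad_vertices[OF V, of A _ D] bary_grad_vertices[OF V, of B _ D]
    by (auto simp: a_def b_def P_def Q_def)
  txt \<open>
    In the plane orthogonal to \<open>CD\<close> the pair \<open>(a, b)\<close> is dual to \<open>(P, Q)\<close>, so its Gram matrix is
    the inverse of that of \<open>(P, Q)\<close>; the off-diagonal entries have opposite signs.
  \<close>
  define R \<Delta> where "R = (P \<bullet> P) *\<^sub>R Q - (P \<bullet> Q) *\<^sub>R P"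
    and "\<Delta> = (P \<bullet> P) * (Q \<bullet> Q) - (P \<bullet> Q) * (P \<bullet> Q)"
  have RL: "R \<bullet> (x - y) = 0" if "x \<in> L" "y \<in> L" for x y
    using PL[OF that] QL[OF that] unfolding R_def by (simp add: inner_diff_left)
  have RP: "R \<bullet> P = 0" "R \<bullet> Q = \<Delta>"
    by (simp_all add: R_def \<Delta>_def inner_diff_left inner_commute[of Q P] mult.commute)
  \<comment> \<open>Both vectors have the same products with the three edge vectors issuing from
    \<open>D\<close>.\<close>
  have "R - \<Delta> *\<^sub>R b = 0"
  proof (rule tetra_vertices_eq_zeroI[OF V, of _ D])
    fix u assume "u \<in> ?V"
    moreover have "(R - \<Delta> *\<^sub>R b) \<bullet> (A - D) = 0" "(R - \<Delta> *\<^sub>R b) \<bullet> (B - D) = 0"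
      using foot[OF RL, of A] foot[OF RL, of B] foot[OF bL, of A] foot[OF bL, of B] RP bP
      by (simp_all add: inner_diff_left P_def[symmetric] Q_def[symmetric])
    moreover have "(R - \<Delta> *\<^sub>R b) \<bullet> (C - D) = 0"
      using RL[OF L(3,4)] bL[OF L(3,4)] by (simp add: inner_diff_left)
    ultimately show "(R - \<Delta> *\<^sub>R b) \<bullet> (u - D) = 0"
      by auto
  qed
  then have R: "R = \<Delta> *\<^sub>R b"
    by simp
  have "P \<noteq> 0" "Q \<noteq> 0"
    using aP bP by auto
  have bR: "b \<bullet> R = P \<bullet> P" and aR: "a \<bullet> R = - (P \<bullet> Q)"
    using aP bP by (simp_all add: R_def inner_diff_right)
  \<comment> \<open>Positivity of the Gram determinant follows from
    \<open>\<Delta> * (b \<bullet> b) = P \<bullet> P\<close>.\<close>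
  have "\<Delta> * (b \<bullet> b) > 0"
    using bR R \<open>P \<noteq> 0\<close> by simp
  then have "\<Delta> > 0"
    using inner_ge_zero[of b] by (auto simp: zero_less_mult_iff)
  have "obtuse_edge (convex hull ?V) (convex hull {C, D}) \<longleftrightarrow> vec_angle P Q > pi / 2"
    using edge_of_tetra[OF V, of C D] dist dihedral_angle_tetra[OF V]
    by (simp add: obtuse_edge_def P_def Q_def L_def)
  also have "\<dots> \<longleftrightarrow> P \<bullet> Q < 0"
    using \<open>P \<noteq> 0\<close> \<open>Q \<noteq> 0\<close> by (rule vec_angle_obtuse_iff)
  also have "\<dots> \<longleftrightarrow> \<Delta> * (a \<bullet> b) > 0"
    using aR R by simp
  also have "\<dots> \<longleftrightarrow> a \<bullet> b > 0"
    using \<open>\<Delta> > 0\<close> by (simp add: zero_less_mult_iff)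
  finally show ?thesis
    by (simp add: a_def b_def)
qed

section \<open>Sign pattern of the products of gradients\<close>

lemma bary_grad_sum:
  assumes V: "tetra_vertices {A, B, C, D}"
  defines "g \<equiv> bary_grad {A, B, C, D}"
  shows "g A + g B + g C + g D = 0"
proof (rule tetra_vertices_eq_zeroI[OF V, of _ D])
  fix u assume "u \<in> {A, B, C, D}"
  then show "(g A + g B + g C + g D) \<bullet> (u - D) = 0"
    using tetra_vertices_distinct[OF V] bary_grad_vertices[OF V, of _ u D]
    by (auto simp: g_def inner_add_left)
qed

text \<open>The three products add up to \<open>- (g A \<bullet> g A)\<close>, since the gradients
  sum to zero.\<close>

lemma bary_grad_not_all_positive:
  assumes V: "tetra_vertices {A, B, C, D}"
  defines "g \<equiv> bary_grad {A, B, C, D}"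
  shows "\<not> (g A \<bullet> g B > 0 \<and> g A \<bullet> g C > 0 \<and> g A \<bullet> g D > 0)"
proof -
  have "g A \<bullet> (g A + g B + g C + g D) = 0"
    unfolding g_def bary_grad_sum[OF V] by simp
  then show ?thesis
    using inner_ge_zero[of "g A"] unfolding inner_add_right by linarith
qed

text \<open>An edge missing \<open>A\<close> joins two of the other three vertices, and the product
  deciding its obtuseness pairs \<open>A\<close> with the third.\<close>

lemma obtuse_edge_avoiding_vertex:
  assumes V: "tetra_vertices {A, B, C, D}"
    and e: "obtuse_edge (convex hull {A, B, C, D}) e" "A \<notin> e"
  defines "g \<equiv> bary_grad {A, B, C, D}"
  shows "g A \<bullet> g B > 0 \<or> g A \<bullet> g C > 0 \<or> g A \<bullet> g D > 0"
proof -
  have perm: "{A, C, B, D} = {A, B, C, D}" "{A, D, B, C} = {A, B, C, D}"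
    by auto
  obtain u v where uv: "u \<in> {A, B, C, D}" "v \<in> {A, B, C, D}" "u \<noteq> v" "e = convex hull {u, v}"
    using edge_eqE[OF V] e(1) unfolding obtuse_edge_def by blast
  have "u \<noteq> A" "v \<noteq> A"
    using e(2) uv(4) by (auto simp: hull_inc)
  then have "{u, v} = {C, D} \<or> {u, v} = {B, D} \<or> {u, v} = {B, C}"
    using uv(1-3) by blast
  then have "e = convex hull {C, D} \<or> e = convex hull {B, D} \<or> e = convex hull {B, C}"
    using uv(4) by metis
  then show ?thesis
    using e(1) obtuse_edge_iff[of A B C D] obtuse_edge_iff[of A C B D] obtuse_edge_iff[of A D B C] V
    unfolding perm g_def by blast
qed

section \<open>Cutting a tetrahedron by a plane\<close>

lemma segment_crosses_plane:
  assumes "k \<bullet> X < r" "k \<bullet> Y > r"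
  obtains p s t where "s > 0" "t > 0" "s + t = 1" "p = s *\<^sub>R X + t *\<^sub>R Y"
    "convex hull {X, Y} \<inter> {x. k \<bullet> x = r} = {p}"
proof -
  \<comment> \<open>These weights solve \<open>k \<bullet> p = r\<close> on the segment.\<close>
  define s t where "s = (k \<bullet> Y - r) / (k \<bullet> Y - k \<bullet> X)" and "t = (r - k \<bullet> X) / (k \<bullet> Y - k \<bullet> X)"
  have st: "s > 0" "t > 0"
    using assms by (auto simp: s_def t_def)
  have st1: "s + t = 1"
    using assms by (simp add: s_def t_def flip: add_divide_distrib)
  have "s * (k \<bullet> X) + t * (k \<bullet> Y) =
      ((k \<bullet> Y - r) * (k \<bullet> X) + (r - k \<bullet> X) * (k \<bullet> Y)) / (k \<bullet> Y - k \<bullet> X)"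
    by (simp add: s_def t_def add_divide_distrib)
  also have "(k \<bullet> Y - r) * (k \<bullet> X) + (r - k \<bullet> X) * (k \<bullet> Y) = r * (k \<bullet> Y - k \<bullet> X)"
    by (simp add: algebra_simps)
  finally have kp: "s * (k \<bullet> X) + t * (k \<bullet> Y) = r"
    using assms by simp
  have "convex hull {X, Y} \<inter> {x. k \<bullet> x = r} = {s *\<^sub>R X + t *\<^sub>R Y}"
  proof
    show "{s *\<^sub>R X + t *\<^sub>R Y} \<subseteq> convex hull {X, Y} \<inter> {x. k \<bullet> x = r}"
      using st st1 kp by (auto simp: convex_hull_2 inner_add_right intro!: less_imp_le)
    show "convex hull {X, Y} \<inter> {x. k \<bullet> x = r} \<subseteq> {s *\<^sub>R X + t *\<^sub>R Y}"
    proof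
      fix x assume "x \<in> convex hull {X, Y} \<inter> {x. k \<bullet> x = r}"
      then obtain u v where x: "x = u *\<^sub>R X + v *\<^sub>R Y" "u + v = 1" "u * (k \<bullet> X) + v * (k \<bullet> Y) = r"
        by (auto simp: convex_hull_2 inner_add_right)
      have "u = 1 - v" "s = 1 - t"
        using x st1 by auto
      then have "(v - t) * (k \<bullet> Y - k \<bullet> X) = 0"
        using x(3) kp unfolding \<open>u = 1 - v\<close> \<open>s = 1 - t\<close> by (simp add: algebra_simps)
      then have "v = t"
        using assms by simp
      with \<open>u = 1 - v\<close> \<open>s = 1 - t\<close> show "x \<in> {s *\<^sub>R X + t *\<^sub>R Y}"
        by (simp add: x)
    qed
  qed
  with st st1 that show thesis
    by blast
qed

text \<open>An extreme point of a set stays extreme in every subset containing it, and the extreme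
  points of the part are exactly the points of \<open>V0\<close>.\<close>

lemma vertex_of_halfspace_part:
  assumes "tetra_vertices V" "tetra_vertices V0"
    and V0: "convex hull V0 = convex hull V \<inter> {x. k \<bullet> x \<le> r}"
    and v: "v \<in> V" "k \<bullet> v \<le> r"
  shows "v \<in> V0"
proof -
  have "v extreme_point_of convex hull V"
    using assms by (simp add: extreme_point_of_convex_hull_affine_independent tetra_vertices_def)
  then have "v extreme_point_of convex hull V0"
    using v by (auto simp: V0 extreme_point_of_def)
  then show ?thesis
    using assms(2) by (simp add: extreme_point_of_convex_hull_affine_independent tetra_vertices_def)
qed

text \<open>The point \<open>p\<close> is the intersection of two faces of the part, namely the
  remainder of the edge and the cut itself; a one-point face is a vertex.\<close>

lemma edge_crossing_of_halfspace_part: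
  assumes V: "tetra_vertices V" "tetra_vertices V0"
    and V0: "convex hull V0 = convex hull V \<inter> {x. k \<bullet> x \<le> r}"
    and X: "X \<in> V" "Y \<in> V" and p: "convex hull {X, Y} \<inter> {x. k \<bullet> x = r} = {p}"
  shows "p \<in> V0"
proof -
  have "{X, Y} \<subseteq> V"
    using X by blast
  then have "convex hull {X, Y} face_of convex hull V" and sub: "convex hull {X, Y} \<subseteq> convex hull V"
    using V face_of_convex_hull_affine_independent[of V] hull_mono[of "{X, Y}" V convex]
    unfolding tetra_vertices_def by blast+
  then have "convex hull {X, Y} \<inter> {x. k \<bullet> x \<le> r} face_of convex hull V0"
    unfolding V0 by (intro face_of_slice convex_halfspace_le)
  moreover have "convex hull V0 \<inter> {x. k \<bullet> x = r} face_of convex hull V0"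
    by (rule face_of_Int_supporting_hyperplane_le[OF convex_convex_hull]) (use V0 in blast)
  ultimately have "(convex hull {X, Y} \<inter> {x. k \<bullet> x \<le> r}) \<inter> (convex hull V0 \<inter> {x. k \<bullet> x = r})
      face_of convex hull V0"
    by (rule face_of_Int)
  also have "(convex hull {X, Y} \<inter> {x. k \<bullet> x \<le> r}) \<inter> (convex hull V0 \<inter> {x. k \<bullet> x = r}) =
      convex hull {X, Y} \<inter> {x. k \<bullet> x = r}"
    unfolding V0 using sub by auto
  finally have "p extreme_point_of convex hull V0"
    by (simp add: p face_of_singleton)
  then show ?thesis
    using V by (simp add: extreme_point_of_convex_hull_affine_independent tetra_vertices_def)
qed

text \<open>
  If the half-space contains two vertices of the tetrahedron in its interior and misses a third one,
  the part it cuts off has at least five extreme points.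
\<close>

lemma halfspace_part_not_tetra:
  assumes V: "tetra_vertices {X, Y, Z, W}" and V0: "tetra_vertices V0"
    and part: "convex hull V0 = convex hull {X, Y, Z, W} \<inter> {x. k \<bullet> x \<le> r}"
    and k: "k \<bullet> X > r" "k \<bullet> Y < r" "k \<bullet> Z < r"
  shows False
proof -
  let ?V = "{X, Y, Z, W}"
  note dist = tetra_vertices_distinct[OF V]
  note vertex = vertex_of_halfspace_part[OF V V0 part]
  note crossing = edge_crossing_of_halfspace_part[OF V V0 part]
  define gY gW where "gY = bary_grad ?V Y" and "gW = bary_grad ?V W"
  have gY: "gY \<bullet> (Y - X) = 1" "gY \<bullet> (Z - X) = 0"
    and gW: "gW \<bullet> (W - X) = 1" "gW \<bullet> (Y - X) = 0" "gW \<bullet> (Z - X) = 0"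
    unfolding gY_def gW_def using dist by (auto simp: bary_grad_vertices[OF V])
  obtain p t s where p: "t > 0" "s > 0" "t + s = 1" "p = t *\<^sub>R Y + s *\<^sub>R X"
      "convex hull {Y, X} \<inter> {x. k \<bullet> x = r} = {p}"
    by (rule segment_crosses_plane[OF k(2,1)])
  obtain q t' s' where q: "t' > 0" "s' > 0" "t' + s' = 1" "q = t' *\<^sub>R Z + s' *\<^sub>R X"
      "convex hull {Z, X} \<inter> {x. k \<bullet> x = r} = {q}"
    by (rule segment_crosses_plane[OF k(3,1)])
  have "p - X = t *\<^sub>R (Y - X)"
    using p(3) by (simp add: p(4) algebra_simps flip: scaleR_add_left)
  then have gp: "gY \<bullet> (p - X) = t" "gW \<bullet> (p - X) = 0"
    by (simp_all add: gY gW)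
  have "q - X = t' *\<^sub>R (Z - X)"
    using q(3) by (simp add: q(4) algebra_simps flip: scaleR_add_left)
  then have gq: "gY \<bullet> (q - X) = 0" "gW \<bullet> (q - X) = 0"
    by (simp_all add: gY gW)
  \<comment> \<open>The fifth extreme point is \<open>W\<close> if it is kept, and otherwise the
    crossing point on \<open>YW\<close>. Its coordinate at \<open>W\<close> is positive, whereas the
    other four points lie in the facet \<open>XYZ\<close>.\<close>
  obtain x where x: "x \<in> V0" "gW \<bullet> (x - X) > 0"
  proof (cases "k \<bullet> W \<le> r")
    case True
    then show thesis
      using that[of W] vertex[of W] gW by simp
  next
    case False
    then have "k \<bullet> W > r"
      by simp
    obtain x u v where x: "u > 0" "v > 0" "u + v = 1" "x = u *\<^sub>R Y + v *\<^sub>R W"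
        "convex hull {Y, W} \<inter> {x. k \<bullet> x = r} = {x}"
      by (rule segment_crosses_plane[OF k(2) \<open>k \<bullet> W > r\<close>])
    have "x - X = u *\<^sub>R (Y - X) + v *\<^sub>R (W - X)"
      using x(3) by (simp add: x(4) algebra_simps flip: scaleR_add_left)
    then have "gW \<bullet> (x - X) = v"
      by (simp add: inner_add_right gW)
    then show thesis
      using that[of x] x crossing[of Y W x] by simp
  qed
  have "p \<in> V0" "q \<in> V0" "Y \<in> V0" "Z \<in> V0"
    using crossing[of Y X p] crossing[of Z X q] p q vertex[of Y] vertex[of Z] k by auto
  then have "card {x, Y, Z, p, q} \<le> card V0"
    using x tetra_vertices_finite[OF V0] by (intro card_mono) auto
  moreover have "k \<bullet> p = r" "k \<bullet> q = r"
    using p(5) q(5) by blast+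
  \<comment> \<open>The functional \<open>k\<close> separates \<open>p\<close> and \<open>q\<close>
    from \<open>Y\<close> and \<open>Z\<close>, \<open>gY\<close> separates \<open>p\<close> from
    \<open>q\<close>, and \<open>gW\<close> separates \<open>x\<close> from all the rest.\<close>
  then have "distinct [x, Y, Z, p, q]"
    using dist k gp gq gW x(2) p(1) by auto
  then have "card (set [x, Y, Z, p, q]) = 5"
    by (subst distinct_card) auto
  ultimately show False
    using V0 by (simp add: tetra_vertices_def)
qed

text \<open>Otherwise the part would lie in the plane, too flat for a tetrahedron.\<close>

lemma tetra_vertices_not_below:
  assumes V: "tetra_vertices V" and V0: "tetra_vertices V0"
    and part: "convex hull V0 = convex hull V \<inter> {x. k \<bullet> x \<le> r}" and "k \<noteq> 0"
  obtains v where "v \<in> V" "k \<bullet> v < r"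
proof (rule ccontr)
  assume "\<not> thesis"
  then have "V \<subseteq> {x. k \<bullet> x \<ge> r}"
    using that by force
  then have "convex hull V \<subseteq> {x. k \<bullet> x \<ge> r}"
    by (intro hull_minimal convex_halfspace_ge)
  then have *: "k \<bullet> u = r" if "u \<in> V0" for u
    using part hull_inc[of u V0 convex] that by force
  have "V0 \<noteq> {}"
    using V0 by (auto simp: tetra_vertices_def)
  then obtain w where "w \<in> V0"
    by blast
  have "k = 0"
    by (rule tetra_vertices_eq_zeroI[OF V0, of _ w])
      (use * \<open>w \<in> V0\<close> in \<open>simp add: inner_diff_right\<close>)
  with \<open>k \<noteq> 0\<close> show False
    by blast
qed

text \<open>The four points are distinct extreme points of the part, and \<open>V0\<close> has only
  four elements.\<close>

lemma halfspace_part_vertices: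
  assumes V: "tetra_vertices {A, B, C, D}" and V0: "tetra_vertices V0"
    and part: "convex hull V0 = convex hull {A, B, C, D} \<inter> {x. k \<bullet> x \<le> r}"
    and k: "k \<bullet> A = r" "k \<bullet> B = r" "k \<bullet> C < r"
    and p: "convex hull {C, D} \<inter> {x. k \<bullet> x = r} = {p}" "p \<noteq> A" "p \<noteq> B"
  shows "V0 = {A, B, C, p}"
proof -
  have "k \<bullet> p = r"
    using p by blast
  then have "distinct [A, B, C, p]"
    using p k tetra_vertices_distinct[OF V] by auto
  then have "card (set [A, B, C, p]) = 4"
    by (subst distinct_card) auto
  moreover have "{A, B, C, p} \<subseteq> V0"
    using vertex_of_halfspace_part[OF V V0 part] k
      edge_crossing_of_halfspace_part[OF V V0 part _ _ p(1)] by auto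
  ultimately show ?thesis
    using V0 card_subset_eq[of V0 "{A, B, C, p}"] tetra_vertices_finite[OF V0]
    by (simp add: tetra_vertices_def)
qed

lemma tetrahedral_subdivisionE:
  assumes "tetrahedron T" "tetrahedral_subdivision H T T0 T1"
  obtains A B C D p s t k r where
    "tetra_vertices {A, B, C, D}" "T = convex hull {A, B, C, D}"
    "tetra_vertices {A, B, C, p}" "T0 = convex hull {A, B, C, p}"
    "tetra_vertices {A, B, D, p}" "T1 = convex hull {A, B, D, p}"
    "H = {x. k \<bullet> x = r}" "k \<bullet> A = r" "k \<bullet> B = r" "k \<bullet> C < r" "k \<bullet> D > r"
    "s > 0" "t > 0" "s + t = 1" "p = s *\<^sub>R C + t *\<^sub>R D" "convex hull {C, D} \<inter> H = {p}"
proof -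
  obtain k r where k: "k \<noteq> 0" "H = {x. k \<bullet> x = r}" "T0 \<subseteq> {x. k \<bullet> x \<le> r}" "T1 \<subseteq> {x. k \<bullet> x \<ge> r}"
    and TT: "T = T0 \<union> T1" "T0 \<inter> T1 = T \<inter> H"
    using assms unfolding tetrahedral_subdivision_def by blast
  obtain V V0 V1 where V: "tetra_vertices V" "T = convex hull V"
    and V0: "tetra_vertices V0" "T0 = convex hull V0"
    and V1: "tetra_vertices V1" "T1 = convex hull V1"
    using assms unfolding tetrahedral_subdivision_def tetrahedron_iff by blast
  \<comment> \<open>Each part is the full slice of \<open>T\<close> by its half-space: off the plane
    the side decides, on the plane \<open>T0 \<inter> T1 = T \<inter> H\<close> does.\<close>
  have "(x \<in> T0 \<longleftrightarrow> x \<in> T \<and> k \<bullet> x \<le> r) \<and> (x \<in> T1 \<longleftrightarrow> x \<in> T \<and> k \<bullet> x \<ge> r)" for x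
  proof (cases "k \<bullet> x = r")
    case True
    then have "x \<in> T \<longleftrightarrow> x \<in> T0 \<and> x \<in> T1"
      using TT k(2) by blast
    then show ?thesis
      using True TT(1) by auto
  next
    case False
    have "x \<in> T0 \<Longrightarrow> k \<bullet> x \<le> r" "x \<in> T1 \<Longrightarrow> k \<bullet> x \<ge> r"
      using k(3,4) by auto
    with False TT(1) show ?thesis
      by auto
  qed
  \<comment> \<open>Negating \<open>k\<close> and \<open>r\<close> brings the upper part into the
    form of a lower one, so the same lemmas apply to both.\<close>
  then have T0: "T0 = T \<inter> {x. k \<bullet> x \<le> r}" and T1: "T1 = T \<inter> {x. (- k) \<bullet> x \<le> - r}"
    by auto
  note part0 = T0[unfolded V V0] and part1 = T1[unfolded V V1]
  obtain C where C: "C \<in> V" "k \<bullet> C < r"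
    using tetra_vertices_not_below[OF V(1) V0(1) part0 k(1)] by blast
  obtain D where D: "D \<in> V" "k \<bullet> D > r"
    using tetra_vertices_not_below[OF V(1) V1(1) part1] k(1) by auto
  have "C \<noteq> D"
    using C D by auto
  then have "card (V - {C, D}) = 2"
    using V(1) C D by (simp add: card_Diff_subset tetra_vertices_def)
  then obtain A B where "V - {C, D} = {A, B}"
    by (auto simp: card_2_iff)
  then have Veq: "V = {A, B, C, D}"
    using C D by blast
  have perm: "{A, B, D, C} = {A, B, C, D}" "{D, A, C, B} = {A, B, C, D}" "{D, B, C, A} = {A, B, C, D}"
    "{C, A, D, B} = {A, B, C, D}" "{C, B, D, A} = {A, B, C, D}"
    by auto
  note V = V[unfolded Veq] and part0 = part0[unfolded Veq] and part1 = part1[unfolded Veq]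
  note not0 = halfspace_part_not_tetra[OF _ V0(1), of _ _ _ _ k r]
    and not1 = halfspace_part_not_tetra[OF _ V1(1), of _ _ _ _ "- k" "- r"]
  \<comment> \<open>If \<open>A\<close> were strictly below, the lower half-space would contain
    \<open>A\<close> and \<open>C\<close> in its interior and miss \<open>D\<close>; strictly above
    is symmetric.\<close>
  have "\<not> k \<bullet> A < r" "\<not> k \<bullet> A > r"
    using not0[of D A C B] not1[of C A D B] V(1) part0 part1 C D
    unfolding perm inner_minus_left neg_less_iff_less by blast+
  then have A: "k \<bullet> A = r"
    by simp
  have "\<not> k \<bullet> B < r" "\<not> k \<bullet> B > r"
    using not0[of D B C A] not1[of C B D A] V(1) part0 part1 C D
    unfolding perm inner_minus_left neg_less_iff_less by blast+
  then have B: "k \<bullet> B = r"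
    by simp
  obtain p s t where p: "s > 0" "t > 0" "s + t = 1" "p = s *\<^sub>R C + t *\<^sub>R D"
      "convex hull {C, D} \<inter> {x. k \<bullet> x = r} = {p}"
    by (rule segment_crosses_plane[OF C(2) D(2)])
  have "A \<notin> convex hull {C, D}" "B \<notin> convex hull {C, D}"
  proof -
    have "convex hull {C, D} \<subseteq> convex hull ({A, B, C, D} - {A})"
      "convex hull {C, D} \<subseteq> convex hull ({A, B, C, D} - {B})"
      using tetra_vertices_distinct[OF V(1)] by (auto intro!: hull_mono)
    then show "A \<notin> convex hull {C, D}" "B \<notin> convex hull {C, D}"
      using vertex_notin_facet[OF V(1), of A] vertex_notin_facet[OF V(1), of B] by blast+
  qed
  then have pAB: "p \<noteq> A" "p \<noteq> B"
    using p(5) by blast+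
  have V0eq: "V0 = {A, B, C, p}"
    by (rule halfspace_part_vertices[OF V(1) V0(1) part0 A B C(2) p(5) pAB])
  have "convex hull {D, C} \<inter> {x. (- k) \<bullet> x = - r} = {p}"
    using p(5) by (simp add: insert_commute)
  then have V1eq: "V1 = {A, B, D, p}"
    using A B D(2) pAB
    by (intro halfspace_part_vertices[OF _ V1(1), of A B D C "- k" "- r", unfolded perm, OF V(1) part1])
      simp_all
  show thesis
    by (rule that[OF V V0[unfolded V0eq] V1[unfolded V1eq] k(2) A B C(2) D(2) p(1-4)
          p(5)[folded k(2)]])
qed

section \<open>Height function subdivisions\<close>

text \<open>
  The parts of the subdivision inherit the gradients at \<open>A\<close> and \<open>B\<close>; at \<open>C\<close> and \<open>p\<close> they are
  \<open>c - (s/t) d\<close> and \<open>d/t\<close>. Each vertex of \<open>A B C p\<close> lies in one of the pairs \<open>{A, C}\<close> and \<open>{B, p}\<close>,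
  so the two corresponding inner products cannot both be positive.
\<close>

lemma height_function_part:
  assumes V: "tetra_vertices {A, B, C, D}" and V0: "tetra_vertices {A, B, C, p}"
    and p: "p = s *\<^sub>R C + t *\<^sub>R D" "s + t = 1" "t > 0"
    and h: "height_function (convex hull {A, B, C, p})"
  defines "g \<equiv> bary_grad {A, B, C, D}"
  assumes BD: "g B \<bullet> g D > 0"
  shows "t * (g A \<bullet> g C) \<le> s * (g A \<bullet> g D)"
proof -
  let ?V0 = "{A, B, C, p}"
  note dist = tetra_vertices_distinct[OF V] and dist0 = tetra_vertices_distinct[OF V0]
  have g: "g v \<bullet> u - g v \<bullet> w = (if u = v then 1 else 0) - (if w = v then 1 else 0)"
    if "v \<in> {A, B, C, D}" "u \<in> {A, B, C, D}" "w \<in> {A, B, C, D}" for u v w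
    using bary_grad_vertices[OF V that] by (simp add: g_def inner_diff_right)
  have s: "s = 1 - t"
    using p by simp
  have gp: "g v \<bullet> p = g v \<bullet> C + t * (g v \<bullet> D - g v \<bullet> C)" for v
    by (simp add: p(1) s algebra_simps)
  have g0: "bary_grad ?V0 A = g A" "bary_grad ?V0 B = g B"
    "bary_grad ?V0 C = g C - (s / t) *\<^sub>R g D" "bary_grad ?V0 p = (1 / t) *\<^sub>R g D"
  proof -
    show "bary_grad ?V0 A = g A"
      using dist g[of A B A] g[of A C A] g[of A D C]
      by (intro bary_grad_unique[OF V0]) (auto simp: inner_diff_right gp)
    show "bary_grad ?V0 B = g B"
      using dist g[of B A B] g[of B C B] g[of B D C]
      by (intro bary_grad_unique[OF V0]) (auto simp: inner_diff_right gp)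
    show "bary_grad ?V0 C = g C - (s / t) *\<^sub>R g D"
    proof (rule bary_grad_unique[OF V0])
      have "g C \<bullet> (A - C) = - 1" "g C \<bullet> (B - C) = - 1" "g D \<bullet> (A - C) = 0" "g D \<bullet> (B - C) = 0"
        "g C \<bullet> (p - C) = - t" "g D \<bullet> (p - C) = t"
        using dist g[of C A C] g[of C B C] g[of C D C] g[of D A C] g[of D B C] g[of D D C]
        by (auto simp: inner_diff_right gp)
      then show "(g C - (s / t) *\<^sub>R g D) \<bullet> (u - C) = - 1" if "u \<in> ?V0" "u \<noteq> C" for u
        using that p(3) s by (auto simp: inner_diff_left)
    qed simp
    show "bary_grad ?V0 p = (1 / t) *\<^sub>R g D"
      using dist p(3) g[of D A C] g[of D B C] g[of D D C]
      by (intro bary_grad_unique[OF V0]) (auto simp: inner_diff_right gp field_simps)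
  qed
  obtain v where v: "v \<in> ?V0" "\<And>u. u \<in> ?V0 \<Longrightarrow> u \<noteq> v \<Longrightarrow> bary_grad ?V0 v \<bullet> bary_grad ?V0 u \<le> 0"
    using height_function_bary_grad[OF V0 h] by blast
  have "g B \<bullet> ((1 / t) *\<^sub>R g D) > 0"
    using BD p(3) by simp
  \<comment> \<open>The positive product rules out \<open>B\<close> and \<open>p\<close> as apex.
    For either remaining apex, \<open>A\<close> or \<open>C\<close>, the product of these two is
    nonpositive.\<close>
  then have "v \<noteq> B" "v \<noteq> p"
    using v(2)[of p] v(2)[of B] dist0 g0 by (auto simp: inner_commute)
  then have "g A \<bullet> (g C - (s / t) *\<^sub>R g D) \<le> 0"
    using v(1) v(2)[of A] v(2)[of C] dist0 g0 by (auto simp: inner_commute)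
  then show ?thesis
    using p(3) by (simp add: inner_diff_right field_simps)
qed

text \<open>Excludes one of the two matchings that cross the plane's edge; the other follows by
  exchanging \<open>A\<close> and \<open>B\<close>.\<close>

lemma height_function_parts:
  assumes V: "tetra_vertices {A, B, C, D}"
    and V0: "tetra_vertices {A, B, C, p}" and V1: "tetra_vertices {A, B, D, p}"
    and p: "p = s *\<^sub>R C + t *\<^sub>R D" "s + t = 1" "s > 0" "t > 0"
    and h: "height_function (convex hull {A, B, C, p})" "height_function (convex hull {A, B, D, p})"
  defines "g \<equiv> bary_grad {A, B, C, D}"
  shows "\<not> (g A \<bullet> g C > 0 \<and> g B \<bullet> g D > 0)"
proof
  assume pos: "g A \<bullet> g C > 0 \<and> g B \<bullet> g D > 0"
  have perm: "{B, A, D, C} = {A, B, C, D}" "{B, A, D, p} = {A, B, D, p}"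
    by auto
  have "t * (g A \<bullet> g C) \<le> s * (g A \<bullet> g D)"
    using height_function_part[OF V V0 p(1,2,4) h(1)] pos by (simp add: g_def)
  \<comment> \<open>Exchanging \<open>A\<close> with \<open>B\<close>, \<open>C\<close> with
    \<open>D\<close> and \<open>s\<close> with \<open>t\<close> turns the second part into the
    first.\<close>
  moreover have "s * (g B \<bullet> g D) \<le> t * (g B \<bullet> g C)"
    using height_function_part[of B A D C p t s] V V1 p h(2) pos unfolding perm
    by (simp add: g_def add.commute)
  moreover have "t * (g A \<bullet> g C) > 0" "s * (g B \<bullet> g D) > 0"
    using p pos by auto
  ultimately have "g A \<bullet> g D > 0" "g B \<bullet> g C > 0"
    using p by (smt (verit) zero_less_mult_iff)+
  then have "(g A + g B) \<bullet> (g C + g D) > 0"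
    using pos by (simp add: inner_add_left inner_add_right)
  moreover have "g C + g D = - (g A + g B)"
    using bary_grad_sum[OF V] unfolding g_def[symmetric] by (simp add: eq_neg_iff_add_eq_0 algebra_simps)
  ultimately show False
    using inner_ge_zero[of "g A + g B"] by (simp only: inner_minus_right)
qed

theorem theorem5p2:
  fixes T H :: "(real^3) set" and n :: nat
  assumes "n \<ge> 2"
    and "class_n_b n T"
    and "affine H" and "aff_dim H = 2"
    and "induces_height_function_subdivision H T"
  shows "(\<exists>!e. e edge_of T \<and> e \<subseteq> H) \<and>
    (\<forall>e e'. opposite_edges T e e' \<and> e \<subseteq> H \<longrightarrow>
      (\<exists>p \<in> rel_interior e'. H \<inter> e' = {p}) \<and> obtuse_edge T e \<and> obtuse_edge T e')"
proof -
  obtain T0 T1 where sub: "tetrahedral_subdivision H T T0 T1"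
    and h: "height_function T0" "height_function T1"
    using assms(5) unfolding induces_height_function_subdivision_def by blast
  have "tetrahedron T"
    using assms(2) by (simp add: class_n_b_def class_n_def)
  then obtain A B C D p s t k r where V: "tetra_vertices {A, B, C, D}" and T: "T = convex hull {A, B, C, D}"
    and V0: "tetra_vertices {A, B, C, p}" "T0 = convex hull {A, B, C, p}"
    and V1: "tetra_vertices {A, B, D, p}" "T1 = convex hull {A, B, D, p}"
    and H: "H = {x. k \<bullet> x = r}" and k: "k \<bullet> A = r" "k \<bullet> B = r" "k \<bullet> C < r" "k \<bullet> D > r"
    and p: "s > 0" "t > 0" "s + t = 1" "p = s *\<^sub>R C + t *\<^sub>R D" "convex hull {C, D} \<inter> H = {p}"
    by (rule tetrahedral_subdivisionE[OF _ sub])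
  note dist = tetra_vertices_distinct[OF V]
  define g where "g = bary_grad {A, B, C, D}"

  \<comment> \<open>The plane misses \<open>C\<close> and \<open>D\<close>, so an edge inside it can
    only join \<open>A\<close> and \<open>B\<close>.\<close>
  have edge_eq: "e = convex hull {A, B}" if e: "e edge_of T" "e \<subseteq> H" for e
  proof -
    obtain u v where uv: "u \<in> {A, B, C, D}" "v \<in> {A, B, C, D}" "u \<noteq> v" "e = convex hull {u, v}"
      using edge_eqE[OF V] e(1) unfolding T by blast
    have "u \<in> H" "v \<in> H"
      using e(2) uv(4) by (auto simp: hull_inc)
    then have "u \<noteq> C" "u \<noteq> D" "v \<noteq> C" "v \<noteq> D"
      using k H by auto
    then have "{u, v} = {A, B}"
      using uv(1-3) by blast
    then show ?thesis
      by (simp add: uv(4))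
  qed
  have AB_sub: "convex hull {A, B} \<subseteq> H"
    unfolding H using k by (intro hull_minimal convex_hyperplane) auto
  have AB_edge: "convex hull {A, B} edge_of T"
    using edge_of_tetra[OF V, of A B] dist by (simp add: T)

  \<comment> \<open>Subclass (b), read vertex by vertex.\<close>
  have avoid: "\<exists>e. obtuse_edge T e \<and> v \<notin> e" if "v \<in> {A, B, C, D}" for v
    using assms(2) V that unfolding class_n_b_def T tetra_vertices_def
    by (metis extreme_point_of_convex_hull_affine_independent)
  have perm: "{B, A, C, D} = {A, B, C, D}" "{C, A, B, D} = {A, B, C, D}" "{D, A, B, C} = {A, B, C, D}"
    "{C, D, A, B} = {A, B, C, D}" "{B, A, C, p} = {A, B, C, p}" "{B, A, D, p} = {A, B, D, p}"
    by auto
  note avoid' = obtuse_edge_avoiding_vertex[where A = A and B = B and C = C and D = D, unfolded perm]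
    obtuse_edge_avoiding_vertex[where A = B and B = A and C = C and D = D, unfolded perm]
    obtuse_edge_avoiding_vertex[where A = C and B = A and C = B and D = D, unfolded perm]
    obtuse_edge_avoiding_vertex[where A = D and B = A and C = B and D = C, unfolded perm]
  \<comment> \<open>In the graph joining vertices with positive product, no vertex is
    isolated.\<close>
  have nbr: "g A \<bullet> g B > 0 \<or> g A \<bullet> g C > 0 \<or> g A \<bullet> g D > 0"
    "g B \<bullet> g A > 0 \<or> g B \<bullet> g C > 0 \<or> g B \<bullet> g D > 0"
    "g C \<bullet> g A > 0 \<or> g C \<bullet> g B > 0 \<or> g C \<bullet> g D > 0"
    "g D \<bullet> g A > 0 \<or> g D \<bullet> g B > 0 \<or> g D \<bullet> g C > 0"
    using avoid[of A] avoid[of B] avoid[of C] avoid[of D] avoid' V unfolding g_def T by blast+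
  \<comment> \<open>No vertex of this graph is joined to all the others.\<close>
  have star: "\<not> (g A \<bullet> g B > 0 \<and> g A \<bullet> g C > 0 \<and> g A \<bullet> g D > 0)"
    "\<not> (g B \<bullet> g A > 0 \<and> g B \<bullet> g C > 0 \<and> g B \<bullet> g D > 0)"
    "\<not> (g C \<bullet> g A > 0 \<and> g C \<bullet> g B > 0 \<and> g C \<bullet> g D > 0)"
    "\<not> (g D \<bullet> g A > 0 \<and> g D \<bullet> g B > 0 \<and> g D \<bullet> g C > 0)"
    using bary_grad_not_all_positive[of A B C D] bary_grad_not_all_positive[of B A C D]
      bary_grad_not_all_positive[of C A B D] bary_grad_not_all_positive[of D A B C] V
    unfolding perm g_def by blast+
  have "\<not> (g A \<bullet> g C > 0 \<and> g B \<bullet> g D > 0)" "\<not> (g B \<bullet> g C > 0 \<and> g A \<bullet> g D > 0)"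
    using height_function_parts[of A B C D p s t] height_function_parts[of B A C D p s t]
      V V0 V1 h p unfolding perm g_def by blast+
  txt \<open>
    A graph on four vertices without isolated vertices contains a perfect matching or is a star.
  \<close>
  with nbr star have pos: "g A \<bullet> g B > 0 \<and> g C \<bullet> g D > 0"
    by (simp only: inner_commute[of "g B" "g A"] inner_commute[of "g C" "g A"]
        inner_commute[of "g D" "g A"] inner_commute[of "g C" "g B"] inner_commute[of "g D" "g B"]
        inner_commute[of "g D" "g C"]) blast
  \<comment> \<open>Each product decides the opposite edge: \<open>AB\<close> is obtuse by the
    product at \<open>C\<close> and \<open>D\<close>, and \<open>CD\<close> by that at
    \<open>A\<close> and \<open>B\<close>.\<close>
  then have obtuse: "obtuse_edge T (convex hull {A, B})" "obtuse_edge T (convex hull {C, D})"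
    using obtuse_edge_iff[of A B C D] obtuse_edge_iff[of C D A B] V unfolding perm g_def T by blast+

  have opposite: "(\<exists>p \<in> rel_interior e'. H \<inter> e' = {p}) \<and> obtuse_edge T e \<and> obtuse_edge T e'"
    if "opposite_edges T e e'" "e \<subseteq> H" for e e'
  proof -
    have e: "e = convex hull {A, B}"
      using that edge_eq by (auto simp: opposite_edges_def)
    have "e' edge_of T" and disj: "e \<inter> e' = {}"
      using that by (auto simp: opposite_edges_def)
    then obtain u v where uv: "u \<in> {A, B, C, D}" "v \<in> {A, B, C, D}" "u \<noteq> v" "e' = convex hull {u, v}"
      using edge_eqE[OF V] unfolding T by blast
    have "A \<in> e" "B \<in> e" "u \<in> e'" "v \<in> e'"
      by (auto simp: e uv(4) hull_inc)
    then have "u \<noteq> A" "u \<noteq> B" "v \<noteq> A" "v \<noteq> B"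
      using disj by auto
    then have "{u, v} = {C, D}"
      using uv(1-3) by blast
    then have e': "e' = convex hull {C, D}"
      by (simp add: uv(4))
    have "p \<in> open_segment C D"
      using p dist by (auto simp: in_segment intro!: exI[of _ t])
    then have "p \<in> rel_interior e'"
      using dist by (simp add: e' rel_interior_closed_segment flip: segment_convex_hull)
    moreover have "H \<inter> e' = {p}"
      using p(5) e' by blast
    ultimately show ?thesis
      using obtuse e e' by blast
  qed
  show ?thesis
    using AB_edge AB_sub edge_eq opposite by blast
qed

end
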